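(* Let $r \ge 2$ be an integer. Suppose that $G$ is an $n$-vertex $K_{r+1}$-free graph satisfying $$\delta(G) > \min\left\{ \frac{3r-4}{3r-2}\,n - \frac{\Delta(G)}{3r-2},~ n - \frac{\Delta(G)+1}{r-1} \right\}.$$ Then $G$ is $r$-partite.
   Context: All graphs are finite and simple. $K_{r+1}$ denotes the complete graph on $r+1$ vertices; $G$ is $K_{r+1}$-free if it contains no copy of $K_{r+1}$ as a subgraph. $\delta(G)$ and $\Delta(G)$ denote the minimum and maximum degree of $G$. A graph is $r$-partite if its vertex set can be partitioned into $r$ (possibly empty) independent sets. *)

theory Defs
  imports Complex_Main "HOL-Library.Disjoint_Sets" "Graph_Theory.Graph_Theory"
begin

text \<open>
  A finite simple graph is a \<^locale>\<open>pair_graph\<close>: finite, loop-free, symmetric, without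
  parallel arcs. An undirected edge \<open>uv\<close> is represented by the two arcs \<open>(u, v)\<close> and \<open>(v, u)\<close>, so
  the degree of a vertex in the undirected sense is its \<^const>\<open>out_degree\<close>.
  For the graph without vertices the minimum and maximum degree are unspecified.
\<close>

definition min_degree :: "('a, 'b) pre_digraph \<Rightarrow> nat" where
  "min_degree G = Min (out_degree G ` verts G)"

definition max_degree :: "('a, 'b) pre_digraph \<Rightarrow> nat" where
  "max_degree G = Max (out_degree G ` verts G)"

definition complete_free :: "nat \<Rightarrow> ('a, 'b) pre_digraph \<Rightarrow> bool" where
  "complete_free m G \<longleftrightarrow> \<not> (\<exists>H. subgraph H G \<and> complete_digraph m H)"

definition independent_in :: "('a, 'b) pre_digraph \<Rightarrow> 'a set \<Rightarrow> bool" where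
  "independent_in G S \<longleftrightarrow>
     S \<subseteq> verts G \<and> (\<forall>u\<in>S. \<forall>v\<in>S. (u, v) \<notin> arcs_ends G)"

definition partite :: "nat \<Rightarrow> ('a, 'b) pre_digraph \<Rightarrow> bool" where
  "partite r G \<longleftrightarrow>
     (\<exists>P :: nat \<Rightarrow> 'a set.
        (\<Union>i<r. P i) = verts G \<and> disjoint_family_on P {..<r} \<and>
        (\<forall>i<r. independent_in G (P i)))"

end

theory Submission
  imports Defs
begin

text \<open>
  Let \<open>d = n - \<delta>(G)\<close>, so every vertex has at most \<open>d\<close> non-neighbours, counting itself, and let \<open>u\<close>
  be a vertex of maximum degree, with \<open>D = n - \<Delta>(G)\<close> non-neighbours.

  If the minimum is the second term, the hypothesis says \<open>(r - 1) d \<le> \<Delta>(G)\<close>. The neighbourhood of \<open>u\<close>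
  is \<open>K\<^sub>r\<close>-free, and this forces it to be a complete \<open>(r - 1)\<close>-partite graph with parts of size \<open>d\<close>.
  Its vertices have no further non-neighbours, so the non-neighbourhood of \<open>u\<close> is independent.

  If it is the first term, the hypothesis says \<open>(3r - 2) d + D < 3n\<close>, and we may add edges until the
  graph is edge-maximal \<open>K\<^sub>r\<^sub>+\<^sub>1\<close>-free. Following Brandt, suppose that \<open>v = u\<close> is adjacent to neither
  end of an edge \<open>w1 w2\<close>. By maximality \<open>v\<close> and \<open>wi\<close> are both joined to some \<open>(r - 1)\<close>-clique \<open>Qi\<close>.
  Take \<open>|Q1 \<inter> Q2|\<close> maximal, give weight 3 to the vertices of \<open>Q1 \<inter> Q2\<close> and weight 1 to the remaining
  vertices of the configuration. Every vertex of \<open>G\<close> then misses weight at least 3, while the total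
  weight is at most \<open>3r - 1\<close> and \<open>u\<close> has weight 1, so \<open>3n \<le> (3r - 2) d + D\<close>, a contradiction. Hence the
  non-neighbours of \<open>u\<close> are independent, and induction on \<open>r\<close> applies to the neighbourhood of \<open>u\<close>.
\<close>

section \<open>Cliques, neighbourhoods and colourings of an adjacency relation\<close>

text \<open>\<open>E\<close> and \<open>V\<close> are separate arguments because the proof both adds
  edges on a fixed vertex set and passes to neighbourhoods with the edges unchanged.\<close>

definition clique_free :: "nat \<Rightarrow> ('a \<Rightarrow> 'a \<Rightarrow> bool) \<Rightarrow> 'a set \<Rightarrow> bool" where
  "clique_free m E V \<longleftrightarrow> (\<forall>K\<subseteq>V. card K = m \<longrightarrow> \<not> pairwise E K)"

definition nbrs :: "('a \<Rightarrow> 'a \<Rightarrow> bool) \<Rightarrow> 'a set \<Rightarrow> 'a \<Rightarrow> 'a set" where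
  "nbrs E V x = {y \<in> V. E x y}"

text \<open>With \<open>E\<close> irreflexive, a vertex of \<open>V\<close> counts among its own
  non-neighbours.\<close>

definition nonnbrs :: "('a \<Rightarrow> 'a \<Rightarrow> bool) \<Rightarrow> 'a set \<Rightarrow> 'a \<Rightarrow> 'a set" where
  "nonnbrs E V x = {y \<in> V. \<not> E x y}"

definition colourable :: "nat \<Rightarrow> ('a \<Rightarrow> 'a \<Rightarrow> bool) \<Rightarrow> 'a set \<Rightarrow> bool" where
  "colourable r E V \<longleftrightarrow>
     (\<exists>c. \<forall>x\<in>V. c x < r \<and> (\<forall>y\<in>V. E x y \<longrightarrow> c x \<noteq> c y))"

lemma nbrs_subset: "nbrs E V x \<subseteq> V"
  by (auto simp: nbrs_def)

lemma card_nbrs_add_nonnbrs: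
  assumes "finite V"
  shows "card (nbrs E V x) + card (nonnbrs E V x) = card V"
proof -
  have "V = nbrs E V x \<union> nonnbrs E V x" "nbrs E V x \<inter> nonnbrs E V x = {}"
    by (auto simp: nbrs_def nonnbrs_def)
  then show ?thesis
    using assms card_Un_disjoint[of "nbrs E V x" "nonnbrs E V x"]
    by (metis finite_Un)
qed

lemma colourable_mono:
  assumes "colourable r E' V" "\<And>x y. E x y \<Longrightarrow> E' x y"
  shows "colourable r E V"
  using assms unfolding colourable_def by blast

text \<open>The vertices of \<open>V\<close> outside \<open>M\<close> all receive the new colour
  \<open>r\<close>.\<close>

lemma colourable_Suc:
  assumes "colourable r E M" "\<And>x y. x \<in> V - M \<Longrightarrow> y \<in> V - M \<Longrightarrow> \<not> E x y"
  shows "colourable (Suc r) E V"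
proof -
  obtain c where c: "\<forall>x\<in>M. c x < r \<and> (\<forall>y\<in>M. E x y \<longrightarrow> c x \<noteq> c y)"
    using assms(1) unfolding colourable_def by blast
  show ?thesis
    unfolding colourable_def
  proof (intro exI[of _ "\<lambda>x. if x \<in> M then c x else r"] ballI conjI impI)
    fix x assume "x \<in> V"
    then show "(if x \<in> M then c x else r) < Suc r"
      using c by (auto simp: less_Suc_eq)
  next
    fix x y assume "x \<in> V" "y \<in> V" "E x y"
    then show "(if x \<in> M then c x else r) \<noteq> (if y \<in> M then c y else r)"
      using c assms(2)[of x y] by (cases "x \<in> M"; cases "y \<in> M") force+
  qed
qed

lemma pairwise_insert_sym:
  assumes "symp E" "pairwise E K" "\<And>y. y \<in> K \<Longrightarrow> E x y"
  shows "pairwise E (insert x K)"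
  using assms by (auto simp: pairwise_insert dest: sympD)

lemma clique_free_nbrs:
  assumes "finite V" "symp E" "irreflp E" "v \<in> V" "clique_free (Suc m) E V"
  shows "clique_free m E (nbrs E V v)"
  unfolding clique_free_def
proof (intro allI impI notI)
  fix K assume K: "K \<subseteq> nbrs E V v" "card K = m" "pairwise E K"
  have "finite K"
    using K(1) assms(1) nbrs_subset by (metis finite_subset)
  moreover have "v \<notin> K"
    using K(1) assms(3) by (auto simp: nbrs_def irreflp_def)
  ultimately have "card (insert v K) = Suc m"
    using K(2) by simp
  moreover have "pairwise E (insert v K)"
    using K by (intro pairwise_insert_sym[OF assms(2)]) (auto simp: nbrs_def)
  moreover have "insert v K \<subseteq> V"
    using K(1) assms(4) nbrs_subset by fastforce
  ultimately show False
    using assms(5) unfolding clique_free_def by blast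
qed

text \<open>If \<open>x\<close> lies in \<open>K\<close>, it is its own witness; otherwise full
  adjacency would make \<open>insert x K\<close> a clique of size \<open>Suc m\<close>.\<close>

lemma clique_has_nonnbr:
  assumes "finite V" "symp E" "clique_free (Suc m) E V"
    and "K \<subseteq> V" "card K = m" "pairwise E K" "x \<in> V" "irreflp E"
  shows "\<exists>y\<in>K. \<not> E x y"
proof (rule ccontr)
  assume "\<not> ?thesis"
  then have all: "\<And>y. y \<in> K \<Longrightarrow> E x y" by blast
  then have "x \<notin> K"
    using assms(8) by (auto simp: irreflp_def)
  then have "card (insert x K) = Suc m"
    using assms(1,4,5) finite_subset by fastforce
  then show False
    using assms(3,4,7) pairwise_insert_sym[OF assms(2,6) all]
    unfolding clique_free_def by blast
qed

text \<open>Otherwise \<open>a\<close>, \<open>b\<close> and \<open>K\<close> would form a clique of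
  size \<open>m + 2\<close>.\<close>

lemma not_adjacent_of_common_clique:
  assumes "finite V" "symp E" "irreflp E" "clique_free (Suc (Suc m)) E V"
    and "K \<subseteq> V" "card K = m" "pairwise E K"
    and "a \<in> V" "b \<in> V" "\<And>y. y \<in> K \<Longrightarrow> E a y" "\<And>y. y \<in> K \<Longrightarrow> E b y"
  shows "\<not> E a b"
proof
  assume ab: "E a b"
  have "a \<notin> K"
    using assms(3,10) by (auto simp: irreflp_def)
  then have "card (insert a K) = Suc m"
    using assms(1,5,6) finite_subset by fastforce
  moreover have "pairwise E (insert a K)"
    using pairwise_insert_sym[OF assms(2,7,10)] .
  moreover have "insert a K \<subseteq> V" using assms(5,8) by blast
  ultimately obtain y where "y \<in> insert a K" "\<not> E b y"
    using clique_has_nonnbr[OF assms(1,2,4) _ _ _ assms(9,3)] by blast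
  then show False
    using ab assms(2,11) by (auto dest: sympD)
qed

section \<open>The extremal Turan case\<close>

text \<open>A neighbour of \<open>v\<close> already has \<open>d\<close> non-neighbours inside the
  neighbourhood, hence none outside. So all vertices outside are joined to the clique
  \<open>K\<close>, which makes them pairwise non-adjacent.\<close>

lemma colourable_of_turan_nbrs:
  assumes "finite V" "symp E" "irreflp E" "clique_free (Suc (Suc m)) E V"
    and d: "\<And>x. x \<in> V \<Longrightarrow> card (nonnbrs E V x) \<le> d"
    and "v \<in> V" and col: "colourable m E (nbrs E V v)"
    and K: "K \<subseteq> nbrs E V v" "card K = m" "pairwise E K"
    and full: "\<And>x. x \<in> nbrs E V v \<Longrightarrow> card (nonnbrs E (nbrs E V v) x) = d"
  shows "colourable (Suc m) E V"
proof -
  let ?M = "nbrs E V v"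
  have eq: "nonnbrs E V x = nonnbrs E ?M x" if "x \<in> ?M" for x
  proof (rule sym, rule card_seteq)
    show "finite (nonnbrs E V x)" using assms(1) by (auto simp: nonnbrs_def)
    show "nonnbrs E ?M x \<subseteq> nonnbrs E V x" by (auto simp: nonnbrs_def nbrs_def)
    show "card (nonnbrs E V x) \<le> card (nonnbrs E ?M x)"
      using full[OF that] d[of x] that by (auto simp: nbrs_def)
  qed
  have joined: "E a y" if "a \<in> V - ?M" "y \<in> K" for a y
  proof -
    have "y \<in> ?M" using that K by blast
    then have "E y a" using eq[of y] that by (auto simp: nonnbrs_def)
    then show ?thesis using assms(2) by (auto dest: sympD)
  qed
  have KV: "K \<subseteq> V" using K nbrs_subset by fastforce
  show "colourable (Suc m) E V"
    using col
  proof (rule colourable_Suc)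
    fix a b assume "a \<in> V - ?M" "b \<in> V - ?M"
    then show "\<not> E a b"
      using not_adjacent_of_common_clique[OF assms(1-4) KV K(2,3)] joined by blast
  qed
qed

text \<open>Induction through the neighbourhood of a vertex, which loses at most \<open>d\<close>
  vertices. The conclusion records the clique and the exact counts because
  \<open>colourable_of_turan_nbrs\<close> needs them one level up.\<close>

lemma turan_extremal:
  assumes "finite V" "symp E" "irreflp E" "clique_free (Suc r) E V"
    and "\<And>x. x \<in> V \<Longrightarrow> card (nonnbrs E V x) \<le> d" "0 < d" "r * d \<le> card V"
  shows "colourable r E V \<and> (\<exists>K\<subseteq>V. card K = r \<and> pairwise E K) \<and>
         (\<forall>x\<in>V. card (nonnbrs E V x) = d) \<and> card V = r * d"
  using assms
proof (induction r arbitrary: V)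
  case 0
  have "V = {}"
  proof (rule ccontr)
    assume "V \<noteq> {}"
    then obtain x where "x \<in> V" by blast
    then have "{x} \<subseteq> V" "card {x} = Suc 0" "pairwise E {x}" by auto
    then show False using 0(4) unfolding clique_free_def by blast
  qed
  then show ?case by (auto simp: colourable_def)
next
  case (Suc r)
  have step: "colourable (Suc r) E V \<and> (\<exists>K\<subseteq>V. card K = Suc r \<and> pairwise E K) \<and>
      card (nonnbrs E V v) = d \<and> card V = Suc r * d" if v: "v \<in> V" for v
  proof -
    let ?M = "nbrs E V v"
    have MV: "?M \<subseteq> V" by (rule nbrs_subset)
    have fM: "finite ?M" using MV Suc.prems(1) finite_subset by blast
    have cs: "card ?M + card (nonnbrs E V v) = card V"
      by (rule card_nbrs_add_nonnbrs[OF Suc.prems(1)])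
    have "card (nonnbrs E ?M x) \<le> d" if "x \<in> ?M" for x
    proof -
      have "card (nonnbrs E ?M x) \<le> card (nonnbrs E V x)"
        using Suc.prems(1) MV by (intro card_mono) (auto simp: nonnbrs_def)
      then show ?thesis using Suc.prems(5)[of x] that MV by force
    qed
    moreover have "r * d \<le> card ?M"
      using cs Suc.prems(5)[OF v] Suc.prems(7) by simp
    ultimately obtain K where IH: "colourable r E ?M" "K \<subseteq> ?M" "card K = r" "pairwise E K"
        "\<And>x. x \<in> ?M \<Longrightarrow> card (nonnbrs E ?M x) = d" "card ?M = r * d"
      using Suc.IH[OF fM Suc.prems(2,3) clique_free_nbrs[OF Suc.prems(1-3) v Suc.prems(4)]
          _ Suc.prems(6)]
      by blast
    have "colourable (Suc r) E V"
      using colourable_of_turan_nbrs[OF Suc.prems(1-5) v IH(1-5)] .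
    moreover have "card (insert v K) = Suc r"
    proof -
      have "v \<notin> K" using IH(2) Suc.prems(3) by (auto simp: nbrs_def irreflp_def)
      then show ?thesis using IH(2,3) fM finite_subset by fastforce
    qed
    moreover have "pairwise E (insert v K)"
      using IH(2,4) by (intro pairwise_insert_sym[OF Suc.prems(2)]) (auto simp: nbrs_def)
    moreover have "insert v K \<subseteq> V" using IH(2) MV v by blast
    \<comment> \<open>The neighbourhood has exactly \<open>r * d\<close> vertices, so at least
      \<open>d\<close> remain outside it.\<close>
    moreover have "card (nonnbrs E V v) = d"
      using cs IH(6) Suc.prems(5)[OF v] Suc.prems(7) by simp
    ultimately show ?thesis using cs IH(6)
      by (intro conjI exI[of _ "insert v K"]) simp_all
  qed
  have "V \<noteq> {}"
    using Suc.prems(6,7) by auto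
  then show ?case using step by blast
qed

lemma colourable_of_large_degree:
  assumes "finite V" "symp E" "irreflp E" "clique_free (Suc (Suc m)) E V"
    and "\<And>x. x \<in> V \<Longrightarrow> card (nonnbrs E V x) \<le> d"
    and v: "v \<in> V" "m * d \<le> card (nbrs E V v)"
  shows "colourable (Suc m) E V"
proof -
  let ?M = "nbrs E V v"
  have MV: "?M \<subseteq> V" by (rule nbrs_subset)
  have fM: "finite ?M" using MV assms(1) finite_subset by blast
  have small: "card (nonnbrs E ?M x) \<le> d" if "x \<in> ?M" for x
  proof -
    have "card (nonnbrs E ?M x) \<le> card (nonnbrs E V x)"
      using assms(1) MV by (intro card_mono) (auto simp: nonnbrs_def)
    then show ?thesis using assms(5)[of x] that MV by force
  qed
  \<comment> \<open>As its own non-neighbour, \<open>v\<close> forces \<open>0 < d\<close>.\<close>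
  have "v \<in> nonnbrs E V v" using v assms(3) by (auto simp: nonnbrs_def irreflp_def)
  then have "0 < card (nonnbrs E V v)" using assms(1) by (auto simp: nonnbrs_def card_gt_0_iff)
  then have "0 < d" using assms(5)[OF v(1)] by simp
  then obtain K where "colourable m E ?M" "K \<subseteq> ?M" "card K = m" "pairwise E K"
        "\<And>x. x \<in> ?M \<Longrightarrow> card (nonnbrs E ?M x) = d"
    using turan_extremal[OF fM assms(2,3) clique_free_nbrs[OF assms(1-3) v(1) assms(4)] small _ v(2)]
    by blast
  then show ?thesis
    using colourable_of_turan_nbrs[OF assms(1-5) v(1)] by blast
qed

section \<open>Edge-maximal clique-free graphs\<close>

text \<open>\<open>F\<close> is a clique-free relation containing \<open>E\<close> with the most
  pairs in \<open>V\<close>. Any further edge between \<open>x\<close> and \<open>y\<close> closes a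
  clique of size \<open>m + 2\<close>; removing its ends leaves \<open>Q\<close>.\<close>

lemma edge_maximal_extension:
  assumes "finite V" "symp E" "irreflp E" "clique_free (Suc (Suc m)) E V"
  obtains F where "symp F" "irreflp F" "clique_free (Suc (Suc m)) F V" "\<And>x y. E x y \<Longrightarrow> F x y"
    "\<And>x y. \<lbrakk>x \<in> V; y \<in> V; x \<noteq> y; \<not> F x y\<rbrakk> \<Longrightarrow>
       \<exists>Q\<subseteq>V. card Q = m \<and> pairwise F Q \<and> (\<forall>q\<in>Q. F x q \<and> F y q)"
proof -
  define P where "P F \<longleftrightarrow> symp F \<and> irreflp F \<and> clique_free (Suc (Suc m)) F V \<and>
    (\<forall>x y. E x y \<longrightarrow> F x y)" for F
  define edges where "edges F = {(x, y) \<in> V \<times> V. F x y}" for F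
  have fin: "finite (edges F)" for F
    using assms(1) by (auto simp: edges_def intro: finite_subset[of _ "V \<times> V"])
  have bound: "card (edges F) \<le> card (V \<times> V)" for F
    using assms(1) by (intro card_mono) (auto simp: edges_def)
  have "P E" using assms by (auto simp: P_def)
  \<comment> \<open>The selection principle asks for a strict bound, hence the
    \<open>Suc\<close>.\<close>
  then obtain F where F: "P F" and max: "\<And>F'. P F' \<Longrightarrow> card (edges F') \<le> card (edges F)"
    using ex_has_greatest_nat[of P E "\<lambda>F. card (edges F)" "Suc (card (V \<times> V))"] bound
    by (metis le_imp_less_Suc)
  have sF: "symp F" and iF: "irreflp F" and cF: "clique_free (Suc (Suc m)) F V"
    using F by (auto simp: P_def)
  show thesis
  proof (rule that[OF sF iF cF])
    show "F x y" if "E x y" for x y using F that by (auto simp: P_def)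
    fix x y assume xy: "x \<in> V" "y \<in> V" "x \<noteq> y" "\<not> F x y"
    define F' where "F' a b \<longleftrightarrow> F a b \<or> (a = x \<and> b = y) \<or> (a = y \<and> b = x)" for a b
    have "symp F'" using sF by (auto simp: F'_def symp_def)
    moreover have "irreflp F'" using iF xy by (auto simp: F'_def irreflp_def)
    moreover have "edges F \<subset> edges F'" using xy by (auto simp: edges_def F'_def)
    then have "\<not> card (edges F') \<le> card (edges F)"
      using psubset_card_mono[OF fin] by (meson not_le)
    then have "\<not> P F'" using max by blast
    ultimately have "\<not> clique_free (Suc (Suc m)) F' V"
      using F by (auto simp: P_def F'_def)
    then obtain K where K: "K \<subseteq> V" "card K = Suc (Suc m)" "pairwise F' K"
      unfolding clique_free_def by blast
    \<comment> \<open>A clique of \<open>F'\<close> that is not one of \<open>F\<close> uses the new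
      edge, so it contains both ends.\<close>
    have "\<not> pairwise F K" using K cF unfolding clique_free_def by blast
    then have in_K: "x \<in> K" "y \<in> K"
      using K(3) by (auto simp: pairwise_def F'_def)
    define Q where "Q = K - {x, y}"
    have "card Q = m"
      using in_K K(1,2) xy(3) assms(1) finite_subset by (fastforce simp: Q_def card_Diff_subset)
    moreover have "pairwise F Q" "\<forall>q\<in>Q. F x q \<and> F y q"
      using K(3) in_K by (fastforce simp: pairwise_def F'_def Q_def)+
    ultimately show "\<exists>Q\<subseteq>V. card Q = m \<and> pairwise F Q \<and> (\<forall>q\<in>Q. F x q \<and> F y q)"
      using K(1) by (intro exI[of _ Q]) (auto simp: Q_def)
  qed
qed

section \<open>Wheel-like configurations and weights\<close>

text \<open>If \<open>Q1\<close> and \<open>Q2\<close> share all but one vertex each, this contains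
  a five-cycle \<open>v q1 w1 w2 q2\<close> joined to the clique \<open>Q1 \<inter> Q2\<close>, a
  generalised wheel. Smaller intersections (the core) are allowed as well.\<close>

definition wheel_like ::
  "nat \<Rightarrow> ('a \<Rightarrow> 'a \<Rightarrow> bool) \<Rightarrow> 'a set \<Rightarrow> 'a \<Rightarrow> 'a \<Rightarrow> 'a \<Rightarrow> 'a set \<Rightarrow> 'a set \<Rightarrow> bool" where
  "wheel_like m E V v w1 w2 Q1 Q2 \<longleftrightarrow>
     v \<in> V \<and> w1 \<in> V \<and> w2 \<in> V \<and> E w1 w2 \<and> \<not> E v w1 \<and> \<not> E v w2 \<and>
     Q1 \<subseteq> V \<and> card Q1 = m \<and> pairwise E Q1 \<and> (\<forall>q\<in>Q1. E v q \<and> E w1 q) \<and>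
     Q2 \<subseteq> V \<and> card Q2 = m \<and> pairwise E Q2 \<and> (\<forall>q\<in>Q2. E v q \<and> E w2 q)"

text \<open>
  Exchanging \<open>q1\<close> and \<open>q2\<close> for \<open>x\<close>: if \<open>|Q1 \<inter> Q2|\<close> is maximal, no vertex misses only two vertices of
  the configuration.
\<close>

lemma wheel_like_extend_core:
  assumes W: "wheel_like m E V v w1 w2 Q1 Q2" and "finite V" "symp E" "irreflp E"
    and x: "x \<in> V" "E x v" "E x w1" "E x w2"
    and q: "q1 \<in> Q1 - Q2" "q2 \<in> Q2 - Q1"
    and adj: "\<And>y. y \<in> Q1 - {q1} \<Longrightarrow> E x y" "\<And>y. y \<in> Q2 - {q2} \<Longrightarrow> E x y"
  shows "wheel_like m E V v w1 w2 (insert x (Q1 - {q1})) (insert x (Q2 - {q2}))"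
    and "card (insert x (Q1 - {q1}) \<inter> insert x (Q2 - {q2})) = Suc (card (Q1 \<inter> Q2))"
proof -
  have fin: "finite Q1" "finite Q2"
    using W assms(2) finite_subset by (auto simp: wheel_like_def)
  have nx: "x \<notin> Q1 - {q1}" "x \<notin> Q2 - {q2}"
    using adj assms(4) by (auto simp: irreflp_def)
  have sym: "E v x" "E w1 x" "E w2 x" using x assms(3) by (auto dest: sympD)
  have "card (insert x (Q1 - {q1})) = m" "card (insert x (Q2 - {q2})) = m"
    using W q nx fin card_Suc_Diff1[of Q1 q1] card_Suc_Diff1[of Q2 q2]
    by (simp_all add: wheel_like_def del: card_Diff_insert card_Diff_singleton)
  moreover have "pairwise E (insert x (Q1 - {q1}))" "pairwise E (insert x (Q2 - {q2}))"
    using W adj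
    by (auto intro!: pairwise_insert_sym[OF assms(3)] simp: wheel_like_def intro: pairwise_mono)
  ultimately show "wheel_like m E V v w1 w2 (insert x (Q1 - {q1})) (insert x (Q2 - {q2}))"
    using W x sym by (auto simp: wheel_like_def)
  have "insert x (Q1 - {q1}) \<inter> insert x (Q2 - {q2}) = insert x (Q1 \<inter> Q2)"
    using q by auto
  \<comment> \<open>\<open>x\<close> may equal \<open>q1\<close> or \<open>q2\<close>, but neither
    lies in the intersection.\<close>
  moreover have "x \<notin> Q1 \<inter> Q2" using nx q by auto
  ultimately show "card (insert x (Q1 - {q1}) \<inter> insert x (Q2 - {q2})) = Suc (card (Q1 \<inter> Q2))"
    using fin by simp
qed

text \<open>One missed core vertex already gives 3. Otherwise three missed vertices of
  \<open>S\<close> are found from the \<open>(m + 1)\<close>-cliques formed by \<open>w1\<close>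
  with \<open>Q1\<close>, \<open>w2\<close> with \<open>Q2\<close>, and \<open>v\<close> with
  either.\<close>

lemma wheel_like_weight:
  assumes W: "wheel_like m E V v w1 w2 Q1 Q2" and "finite V" "symp E" "irreflp E"
    and cf: "clique_free (Suc (Suc m)) E V"
    and max: "\<And>Q1' Q2'. wheel_like m E V v w1 w2 Q1' Q2' \<Longrightarrow> card (Q1' \<inter> Q2') \<le> card (Q1 \<inter> Q2)"
    and x: "x \<in> V"
  defines "C \<equiv> Q1 \<inter> Q2" and "S \<equiv> insert v (insert w1 (insert w2 (Q1 \<union> Q2))) - Q1 \<inter> Q2"
  shows "3 \<le> 3 * card {y \<in> C. \<not> E y x} + card {y \<in> S. \<not> E y x}"
proof (cases "{y \<in> C. \<not> E y x} = {}")
  case False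
  have "finite C" using W assms(2) finite_subset by (auto simp: wheel_like_def C_def)
  then have "card {y \<in> C. \<not> E y x} \<ge> 1" using False by (simp add: Suc_leI card_gt_0_iff)
  then show ?thesis by simp
next
  case True
  have comm: "E a b \<longleftrightarrow> E b a" for a b using assms(3) by (auto dest: sympD)
  have irr: "\<not> E a a" for a using assms(4) by (auto simp: irreflp_def)
  have fin: "finite Q1" "finite Q2"
    using W assms(2) finite_subset by (auto simp: wheel_like_def)
  have finS: "finite {y \<in> S. \<not> E y x}" using fin by (simp add: S_def)
  have notin: "v \<notin> Q1" "v \<notin> Q2" "w1 \<notin> Q1" "w1 \<notin> Q2" "w2 \<notin> Q1" "w2 \<notin> Q2"
    using W irr by (auto simp: wheel_like_def)
  have dist: "v \<noteq> w1" "v \<noteq> w2" "w1 \<noteq> w2" using W irr comm by (auto simp: wheel_like_def)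
  have core: "E x y" if "y \<in> Q1" "y \<in> Q2" for y using True that comm by (auto simp: C_def)
  have miss: "\<exists>y\<in>insert a Q. \<not> E x y"
    if "a \<in> V" "Q \<subseteq> V" "card Q = m" "pairwise E Q" "\<forall>q\<in>Q. E a q" "finite Q" "a \<notin> Q" for a Q
    using that x
    by (intro clique_has_nonnbr[OF assms(2,3) cf] pairwise_insert_sym[OF assms(3)] assms(4)) auto
  have m1: "\<exists>y\<in>insert w1 Q1. \<not> E x y" and m2: "\<exists>y\<in>insert w2 Q2. \<not> E x y"
    and m3: "\<exists>y\<in>insert v Q1. \<not> E x y" and m4: "\<exists>y\<in>insert v Q2. \<not> E x y"
    using W fin notin by (intro miss; auto simp: wheel_like_def)+
  have three: ?thesis if "a \<in> S" "b \<in> S" "c \<in> S" "\<not> E x a" "\<not> E x b" "\<not> E x c"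
      "a \<noteq> b" "a \<noteq> c" "b \<noteq> c" for a b c
  proof -
    have "{a, b, c} \<subseteq> {y \<in> S. \<not> E y x}" using that comm by auto
    from card_mono[OF finS this] show ?thesis using that by simp
  qed
  show ?thesis
  proof (cases "E x v")
    case False
    \<comment> \<open>Here \<open>v\<close> is the third missed vertex, and
      \<open>y1 \<noteq> y2\<close> because a common vertex would lie in the core, where nothing is
      missed.\<close>
    obtain y1 y2 where "y1 \<in> insert w1 Q1" "\<not> E x y1" "y2 \<in> insert w2 Q2" "\<not> E x y2"
      using m1 m2 by blast
    then show ?thesis
      using three[of v y1 y2] False notin dist core by (auto simp: S_def)
  next
    case True
    obtain q1 q2 where q: "q1 \<in> Q1" "\<not> E x q1" "q2 \<in> Q2" "\<not> E x q2"
      using m3 m4 True by blast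
    then have q': "q1 \<in> Q1 - Q2" "q2 \<in> Q2 - Q1" using core by auto
    show ?thesis
    proof (rule ccontr)
      \<comment> \<open>Without a third missed vertex, exchanging \<open>q1\<close> and
        \<open>q2\<close> for \<open>x\<close> enlarges the core.\<close>
      assume neg: "\<not> ?thesis"
      have only: "E x y" if "y \<in> S" "y \<noteq> q1" "y \<noteq> q2" for y
        using three[of q1 q2 y] neg that q q' by (auto simp: S_def)
      have "E x w1" "E x w2" using only notin q by (auto simp: S_def)
      moreover have "E x y" if "y \<in> Q1 - {q1}" for y
        using only[of y] core[of y] that q' by (auto simp: S_def)
      moreover have "E x y" if "y \<in> Q2 - {q2}" for y
        using only[of y] core[of y] that q' by (auto simp: S_def)
      ultimately show False
        using wheel_like_extend_core[OF W assms(2-4) x True _ _ q'] max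
        by (metis not_less_eq_eq order_refl)
    qed
  qed
qed

lemma sum_card_nonadjacent:
  assumes "finite V" "finite S"
  shows "(\<Sum>x\<in>V. card {y \<in> S. \<not> E y x}) = (\<Sum>y\<in>S. card (nonnbrs E V y))"
proof -
  have "(\<Sum>x\<in>V. card {y \<in> S. \<not> E y x}) = (\<Sum>x\<in>V. \<Sum>y\<in>S. if \<not> E y x then 1 else 0)"
    using assms(2) by (simp add: sum.If_cases Int_def)
  also have "\<dots> = (\<Sum>y\<in>S. \<Sum>x\<in>V. if \<not> E y x then 1 else 0)"
    by (rule sum.swap)
  also have "\<dots> = (\<Sum>y\<in>S. card (nonnbrs E V y))"
    using assms(1) by (simp add: sum.If_cases Int_def nonnbrs_def)
  finally show ?thesis .
qed

text \<open>Double counting of the missed weight. With a core of size \<open>c\<close> the total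
  weight is \<open>3 * c + 3 + 2 * (m - c)\<close>, at most \<open>3 * m + 2\<close> since
  \<open>c < m\<close>, and one unit of it belongs to \<open>v\<close>.\<close>

lemma wheel_like_bound:
  assumes W0: "wheel_like m E V v w1 w2 Q1 Q2" and "finite V" "symp E" "irreflp E"
    and cf: "clique_free (Suc (Suc m)) E V"
    and d: "\<And>x. x \<in> V \<Longrightarrow> card (nonnbrs E V x) \<le> d"
  shows "3 * card V \<le> (3 * m + 1) * d + card (nonnbrs E V v)"
proof -
  \<comment> \<open>Only the two cliques vary, as a pair; \<open>v\<close>, \<open>w1\<close> and
    \<open>w2\<close> stay fixed.\<close>
  define P where "P p \<longleftrightarrow> wheel_like m E V v w1 w2 (fst p) (snd p)" for p
  have "P (Q1, Q2)" using W0 by (simp add: P_def)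
  moreover have "card (fst p \<inter> snd p) < Suc m" if "P p" for p
    using that assms(2) card_mono[of "fst p" "fst p \<inter> snd p"] finite_subset[of "fst p" V]
    by (auto simp: P_def wheel_like_def)
  ultimately obtain p where p: "P p"
      "\<And>p'. P p' \<Longrightarrow> card (fst p' \<inter> snd p') \<le> card (fst p \<inter> snd p)"
    using ex_has_greatest_nat[of P "(Q1, Q2)" "\<lambda>p. card (fst p \<inter> snd p)" "Suc m"] by blast
  obtain R1 R2 where R: "p = (R1, R2)" by (cases p)
  have W: "wheel_like m E V v w1 w2 R1 R2" using p(1) by (simp add: P_def R)
  have max: "card (R1' \<inter> R2') \<le> card (R1 \<inter> R2)" if "wheel_like m E V v w1 w2 R1' R2'" for R1' R2'
    using p(2)[of "(R1', R2')"] that by (simp add: P_def R)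
  define C where "C = R1 \<inter> R2"
  define S where "S = insert v (insert w1 (insert w2 (R1 \<union> R2))) - R1 \<inter> R2"
  have fin: "finite R1" "finite R2"
    using W assms(2) finite_subset by (auto simp: wheel_like_def)
  have comm: "E a b \<longleftrightarrow> E b a" for a b using assms(3) by (auto dest: sympD)
  have irr: "\<not> E a a" for a using assms(4) by (auto simp: irreflp_def)
  have notin: "v \<notin> R1" "v \<notin> R2" "w1 \<notin> R1" "w1 \<notin> R2" "w2 \<notin> R1" "w2 \<notin> R2"
    using W irr by (auto simp: wheel_like_def)
  have dist: "v \<noteq> w1" "v \<noteq> w2" "w1 \<noteq> w2" using W irr comm by (auto simp: wheel_like_def)
  have finCS: "finite C" "finite S" using fin by (auto simp: C_def S_def)
  have sub: "C \<subseteq> V" "S \<subseteq> V" using W by (auto simp: C_def S_def wheel_like_def)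
  have cR: "card R1 = m" "card R2 = m" using W by (auto simp: wheel_like_def)
  \<comment> \<open>Otherwise \<open>R1 = R2\<close> would be an \<open>m\<close>-clique joined to
    both ends of the edge from \<open>w1\<close> to \<open>w2\<close>.\<close>
  have "C \<noteq> R1"
  proof
    assume "C = R1"
    then have eq: "R1 = R2" using fin cR by (metis C_def card_subset_eq inf_le2)
    have "\<not> E w1 w2"
      using W eq by (intro not_adjacent_of_common_clique[OF assms(2-4) cf, of R1])
        (auto simp: wheel_like_def)
    then show False using W by (simp add: wheel_like_def)
  qed
  then have Cm: "card C < m"
    using fin cR by (metis C_def inf_le1 psubsetI psubset_card_mono)
  have cS: "card S = 3 + 2 * (m - card C)"
  proof -
    have "S = insert v (insert w1 (insert w2 ((R1 - C) \<union> (R2 - C))))"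
      using notin by (auto simp: S_def C_def)
    moreover have "card ((R1 - C) \<union> (R2 - C)) = card (R1 - C) + card (R2 - C)"
      using fin by (intro card_Un_disjoint) (auto simp: C_def)
    moreover have "card (R1 - C) = m - card C" "card (R2 - C) = m - card C"
      using fin cR finCS by (auto simp: card_Diff_subset C_def)
    ultimately show ?thesis using notin dist fin by simp
  qed
  have "3 * card V = (\<Sum>x\<in>V. 3)" by simp
  also have "\<dots> \<le> (\<Sum>x\<in>V. 3 * card {y \<in> C. \<not> E y x} + card {y \<in> S. \<not> E y x})"
    unfolding C_def S_def by (intro sum_mono wheel_like_weight[OF W assms(2-4) cf max])
  also have "\<dots> = 3 * (\<Sum>y\<in>C. card (nonnbrs E V y)) + (\<Sum>y\<in>S. card (nonnbrs E V y))"
    using sum_card_nonadjacent[OF assms(2) finCS(1)]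
      sum_card_nonadjacent[OF assms(2) finCS(2)]
    by (simp add: sum.distrib flip: sum_distrib_left)
  also have "(\<Sum>y\<in>C. card (nonnbrs E V y)) \<le> card C * d"
    using d sub sum_bounded_above[of C "\<lambda>y. card (nonnbrs E V y)" d] by auto
  \<comment> \<open>\<open>v\<close> is split off to keep its exact count instead of the bound
    \<open>d\<close>.\<close>
  also have "(\<Sum>y\<in>S. card (nonnbrs E V y)) \<le> card (nonnbrs E V v) + (2 + 2 * (m - card C)) * d"
  proof -
    have vS: "v \<in> S" using notin by (auto simp: S_def)
    have "(\<Sum>y\<in>S - {v}. card (nonnbrs E V y)) \<le> card (S - {v}) * d"
      using d sub sum_bounded_above[of "S - {v}" "\<lambda>y. card (nonnbrs E V y)" d] by auto
    moreover have "card (S - {v}) = 2 + 2 * (m - card C)" using vS finCS cS by simp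
    ultimately show ?thesis using sum.remove[OF finCS(2) vS, of "\<lambda>y. card (nonnbrs E V y)"] by simp
  qed
  finally have "3 * card V \<le> (3 * card C + 2 + 2 * (m - card C)) * d + card (nonnbrs E V v)"
    by (simp add: algebra_simps)
  also have "\<dots> \<le> (3 * m + 1) * d + card (nonnbrs E V v)"
    using Cm by (intro add_right_mono mult_right_mono) auto
  finally show ?thesis .
qed

section \<open>Induction for the first term of the minimum\<close>

text \<open>\<open>u\<close> need not have maximum degree: in the inductive step the inequality
  holds for every vertex of the neighbourhood. \<open>E\<close> is generalised because the induction
  continues with the extension \<open>F\<close>.\<close>

lemma colourable_of_degree_sum:
  assumes "finite V" "symp E" "irreflp E" "clique_free (Suc (Suc m)) E V"
    and "\<And>x. x \<in> V \<Longrightarrow> card (nonnbrs E V x) \<le> d"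
    and "u \<in> V" "(3 * m + 1) * d + card (nonnbrs E V u) < 3 * card V"
  shows "colourable (Suc m) E V"
  using assms
proof (induction m arbitrary: E V u)
  case 0
  have "\<not> E x y" if "x \<in> V" "y \<in> V" for x y
    using not_adjacent_of_common_clique[OF 0(1-4), of "{}"] that by auto
  then show ?case by (intro colourable_Suc[of 0 E "{}"]) (auto simp: colourable_def)
next
  case (Suc m)
  obtain F where F: "symp F" "irreflp F" "clique_free (Suc (Suc (Suc m))) F V"
    and EF: "\<And>x y. E x y \<Longrightarrow> F x y"
    and common: "\<And>x y. \<lbrakk>x \<in> V; y \<in> V; x \<noteq> y; \<not> F x y\<rbrakk> \<Longrightarrow>
       \<exists>Q\<subseteq>V. card Q = Suc m \<and> pairwise F Q \<and> (\<forall>q\<in>Q. F x q \<and> F y q)"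
    using edge_maximal_extension[OF Suc.prems(1-4)] by blast
  have comm: "F a b \<longleftrightarrow> F b a" for a b using F(1) by (auto dest: sympD)
  have le: "card (nonnbrs F V x) \<le> card (nonnbrs E V x)" for x
    using Suc.prems(1) EF by (intro card_mono) (auto simp: nonnbrs_def)
  have dF: "card (nonnbrs F V x) \<le> d" if "x \<in> V" for x
    using le[of x] Suc.prems(5)[OF that] by simp
  have indep: "\<not> F w1 w2" if w: "w1 \<in> V" "w2 \<in> V" "\<not> F u w1" "\<not> F u w2" for w1 w2
  proof
    assume a: "F w1 w2"
    \<comment> \<open>If \<open>u\<close> were one end of the edge, it would be adjacent to the
      other.\<close>
    then have ne: "u \<noteq> w1" "u \<noteq> w2" using w comm by auto
    obtain Q1 Q2 where "wheel_like (Suc m) F V u w1 w2 Q1 Q2"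
      using common[OF Suc.prems(6) w(1) ne(1)] common[OF Suc.prems(6) w(2) ne(2)] a w Suc.prems(6)
      unfolding wheel_like_def by blast
    from wheel_like_bound[OF this Suc.prems(1) F dF]
    show False using Suc.prems(7) le[of u] by simp
  qed
  let ?M = "nbrs F V u"
  have MV: "?M \<subseteq> V" by (rule nbrs_subset)
  have fM: "finite ?M" using MV Suc.prems(1) finite_subset by blast
  have "colourable (Suc m) F ?M"
  proof (cases "?M = {}")
    case True
    then show ?thesis by (simp add: colourable_def)
  next
    case False
    then obtain u' where u': "u' \<in> ?M" by blast
    have dM: "card (nonnbrs F ?M x) \<le> d" if "x \<in> ?M" for x
    proof -
      have "card (nonnbrs F ?M x) \<le> card (nonnbrs F V x)"
        using Suc.prems(1) MV by (intro card_mono) (auto simp: nonnbrs_def)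
      then show ?thesis using dF[of x] that MV by force
    qed
    \<comment> \<open>The right side drops by three times the number of non-neighbours of
      \<open>u\<close>. One copy is absorbed by the given term through \<open>le\<close>, the other
      two cost at most \<open>2 * d\<close>, and of the remaining \<open>(3 * m + 2) * d\<close> one
      \<open>d\<close> covers \<open>u'\<close>.\<close>
    have "(3 * m + 1) * d + card (nonnbrs F ?M u') < 3 * card ?M"
      using dM[OF u'] card_nbrs_add_nonnbrs[OF Suc.prems(1), of F u] Suc.prems(7) le[of u]
        dF[OF Suc.prems(6)]
      by (simp add: algebra_simps)
    then show ?thesis
      using Suc.IH[OF fM F(1,2) clique_free_nbrs[OF Suc.prems(1) F(1,2) Suc.prems(6) F(3)] dM u']
      by blast
  qed
  then have "colourable (Suc (Suc m)) F V"
    by (rule colourable_Suc) (use indep in \<open>auto simp: nbrs_def\<close>)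
  then show ?case using EF by (rule colourable_mono)
qed

section \<open>Transfer to pair graphs and the degree condition\<close>

lemma clique_free_of_complete_free:
  assumes "pair_graph G" "complete_free m (with_proj G)"
  shows "clique_free m (\<lambda>x y. (x, y) \<in> parcs G) (pverts G)"
  unfolding clique_free_def
proof (intro allI impI notI)
  fix K assume K: "K \<subseteq> pverts G" "card K = m" "pairwise (\<lambda>x y. (x, y) \<in> parcs G) K"
  interpret G: pair_graph G by fact
  define H where "H = \<lparr>pverts = K, parcs = {(x, y). x \<in> K \<and> y \<in> K \<and> x \<noteq> y}\<rparr>"
  have fK: "finite K" using K(1) G.pair_finite_verts by (rule finite_subset)
  have "parcs H \<subseteq> K \<times> K" by (auto simp: H_def)
  then have fH: "finite (parcs H)" using fK finite_subset by blast
  interpret H: pair_graph H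
    by unfold_locales (use fK fH in \<open>auto simp: H_def symmetric_def sym_def arcs_ends_def arc_to_ends_def\<close>)
  have "subgraph (with_proj H) (with_proj G)"
  proof (rule subgraphI)
    show "arcs (with_proj H) \<subseteq> arcs (with_proj G)" using K(3) by (auto simp: H_def pairwise_def)
  qed (use K(1) H.wf_digraph G.wf_digraph in \<open>auto simp: H_def compatible_def\<close>)
  moreover have "complete_digraph m (with_proj H)"
    unfolding complete_digraph_def
    using K(2) H.graph_axioms by (auto simp: H_def arcs_ends_def arc_to_ends_def)
  ultimately show False using assms(2) unfolding complete_free_def by blast
qed

lemma partite_of_colourable:
  assumes "colourable r (\<lambda>x y. (x, y) \<in> parcs G) (pverts G)"
  shows "partite r (with_proj G)"
proof -
  obtain c where c: "\<forall>x\<in>pverts G. c x < r \<and> (\<forall>y\<in>pverts G. (x, y) \<in> parcs G \<longrightarrow> c x \<noteq> c y)"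
    using assms unfolding colourable_def by blast
  show ?thesis
    unfolding partite_def
    using c
    by (intro exI[of _ "\<lambda>i. {x \<in> pverts G. c x = i}"])
      (force simp: disjoint_family_on_def independent_in_def arcs_ends_def arc_to_ends_def)
qed

lemma (in pair_graph) out_degree_eq_card_nbrs:
  "out_degree (with_proj G) x = card (nbrs (\<lambda>x y. (x, y) \<in> parcs G) (pverts G) x)"
proof -
  have "out_arcs (with_proj G) x = Pair x ` nbrs (\<lambda>x y. (x, y) \<in> parcs G) (pverts G) x"
    by (auto simp: nbrs_def out_arcs_def dest: in_arcsD2)
  then show ?thesis
    unfolding out_degree_def by (simp add: card_image inj_on_def)
qed

theorem theorem1p3:
  fixes r n :: nat and G :: "'a pair_pre_digraph"
  assumes "r \<ge> 2"
    and "pair_graph G"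
    and "card (pverts G) = n"
    and "complete_free (r + 1) (with_proj G)"
    and "real (min_degree (with_proj G)) >
      min ((3 * real r - 4) / (3 * real r - 2) * real n
             - real (max_degree (with_proj G)) / (3 * real r - 2))
          (real n - (real (max_degree (with_proj G)) + 1) / (real r - 1))"
  shows "partite r (with_proj G)"
proof (cases "pverts G = {}")
  \<comment> \<open>Minimum and maximum degree are unspecified here, so this case is settled without
    the degree condition.\<close>
  case True
  then show ?thesis
    by (intro partite_of_colourable) (simp add: colourable_def)
next
  case False
  interpret G: pair_graph G by fact
  define E where "E x y \<longleftrightarrow> (x, y) \<in> parcs G" for x y
  let ?V = "pverts G"
  let ?delta = "min_degree (with_proj G)" and ?Delta = "max_degree (with_proj G)"
  \<comment> \<open>The coefficients \<open>3 * r - 4\<close>, \<open>3 * r - 2\<close> and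
    \<open>r - 1\<close> become \<open>3 * m - 1\<close>, \<open>3 * m + 1\<close> and
    \<open>m\<close>.\<close>
  obtain m where m: "r = Suc m" "m \<ge> 1" using assms(1) by (cases r) auto
  have fin: "finite ?V" by simp
  have sym: "symp E" unfolding E_def using G.arcs_symmetric by (auto intro: sympI)
  have irr: "irreflp E" unfolding E_def using G.no_loops' by (auto simp: irreflp_def)
  have cf: "clique_free (Suc (Suc m)) E ?V"
    using clique_free_of_complete_free[OF assms(2,4)] m unfolding E_def by simp
  have deg: "out_degree (with_proj G) x = card (nbrs E ?V x)" for x
    using G.out_degree_eq_card_nbrs unfolding E_def by simp
  have split: "card (nbrs E ?V x) + card (nonnbrs E ?V x) = n" for x
    using card_nbrs_add_nonnbrs[OF fin] assms(3) by simp
  have ge: "?delta \<le> card (nbrs E ?V x)" if "x \<in> ?V" for x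
    unfolding min_degree_def using that deg[of x, symmetric] by (intro Min_le) auto
  have "?Delta \<in> out_degree (with_proj G) ` ?V"
    unfolding max_degree_def using False Max_in[of "out_degree (with_proj G) ` ?V"] by simp
  then obtain u where u: "u \<in> ?V" "card (nbrs E ?V u) = ?Delta" using deg by auto
  define d where "d = n - ?delta"
  have d: "card (nonnbrs E ?V x) \<le> d" if "x \<in> ?V" for x
    using ge[OF that] split[of x] by (simp add: d_def)
  \<comment> \<open>The subtraction in \<open>d\<close> is not truncated, as the minimum degree is
    at most \<open>n\<close>.\<close>
  have rd: "real d = real n - real ?delta"
    using ge[OF u(1)] split[of u] by (simp add: d_def)
  have rD: "real (card (nonnbrs E ?V u)) = real n - real ?Delta"
    using split[of u] u(2) by linarith
  consider
      "real ?delta > (3 * real r - 4) / (3 * real r - 2) * real n - real ?Delta / (3 * real r - 2)"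
    | "real ?delta > real n - (real ?Delta + 1) / (real r - 1)"
    using assms(5) by linarith
  then have "colourable (Suc m) E ?V"
  proof cases
    case 1
    have pos: "3 * real m + 1 > 0" by simp
    have "real ?delta * (3 * real m + 1) > (3 * real m - 1) * real n - real ?Delta"
      using 1 pos m(1) by (simp add: pos_divide_less_eq add.commute flip: diff_divide_distrib)
    then have "(3 * real m + 1) * (real n - real ?delta) + (real n - real ?Delta) < 3 * real n"
      by (simp add: algebra_simps)
    then have "real ((3 * m + 1) * d + card (nonnbrs E ?V u)) < real (3 * card ?V)"
      by (simp add: rd rD assms(3) algebra_simps)
    then have "(3 * m + 1) * d + card (nonnbrs E ?V u) < 3 * card ?V"
      by (simp only: of_nat_less_iff)
    then show ?thesis using colourable_of_degree_sum[OF fin sym irr cf d u(1)] by blast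
  next
    case 2
    have "real m * real d < real ?Delta + 1"
      unfolding rd using 2 m by (simp add: field_simps)
    then have "real (m * d) < real (?Delta + 1)" by simp
    \<comment> \<open>The \<open>+ 1\<close> in the second term turns the strict inequality into
      this weak one over the naturals.\<close>
    then have "m * d \<le> card (nbrs E ?V u)"
      using u(2) by (simp only: of_nat_less_iff)
    then show ?thesis using colourable_of_large_degree[OF fin sym irr cf d u(1)] by blast
  qed
  then show ?thesis
    unfolding E_def m(1) by (rule partite_of_colourable)
qed

end
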